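(* Let $p:\widetilde{\mathcal W}\to\mathcal W$ be a covering of $2$-Weyl graphs of type $M$. Then the induced homomorphism of fundamental groupoids $\bar p:\overline{\widetilde{\mathcal W}}\to\overline{\mathcal W}$, $[\beta]\mapsto[p\circ\beta]$, is a covering of groupoids.
   Context: Setting. $M=(m_{st})_{s,t\in S}$ is a Coxeter matrix on a finite set $S$, and $W=\langle S\mid (st)^{m_{st}}=1,\ m_{st}<\infty\rangle$ is its Coxeter group. A word over $S$ is reduced if no shorter word represents the same element of $W$. For $s\ne t$ let $p_m(s,t)=stst\cdots$ ($m$ letters), and if $m_{st}<\infty$ let $p(s,t)=p_{m_{st}}(s,t)$. Groupoids are small and non-empty, with composition $g;h$ (or $gh$) written left to right, defined when $\tau(g)=\iota(h)$, where $\iota,\tau$ denote initial and terminal vertices. Weyl data. A generalized chamber system $\mathcal W$ of type $M$ is a set $\mathcal W_0$ of chambers with a family of groupoids $(\mathcal W_s)_{s\in S}$ (panel groupoids), each with vertex set $\mathcal W_0$. An edge of $\mathcal W$ of type $s$ is a non-identity edge of $\mathcal W_s$ (edges of different types are distinct). An $s$-panel is a connected component of $\mathcal W_s$. A gallery $\beta$ is a finite sequence of consecutive edges (a trivial gallery is a single chamber with no edges), with initial chamber $\iota(\beta)$, terminal chamber $\tau(\beta)$, type $\beta_S$ (the word of types of its edges), and $W$-length $\beta_W\in W$ (the element represented by $\beta_S$). It is a cycle if $\iota(\beta)=\tau(\beta)$, and a geodesic if $\beta_S$ is reduced. For $s\neq t$ with $m_{st}<\infty$: an $(s,t)$-geodesic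 is a geodesic of type $p_m(s,t)$ for some $m$; a maximal $(s,t)$-geodesic is a gallery of type $p(s,t)$; an $(s,t)$-cycle is a cycle of type $p_{2m_{st}}(s,t)$. An alternating geodesic is an $(s,t)$-geodesic for some $s,t$; trivial galleries and one-edge galleries count as alternating geodesics. Weyl data of type $M$ is a generalized chamber system of type $M$ together with, for each ordered pair $(s,t)$ with $s\neq t$, $m_{st}<\infty$, a set of $(s,t)$-cycles called defining suites. Homotopy. Elementary homotopies of galleries are the following moves on subgalleries and their inverses: delete $i\,i^{-1}$; replace $i\,i'$ ($i,i'$ of the same type, $i'\ne i^{-1}$) by the single edge $i;i'$; delete a defining suite. Galleries are homotopic ($\sim$) if related by finitely many such moves. A suite is an $(s,t)$-cycle homotopic to a trivial gallery. The fundamental groupoid $\overline{\mathcal W}$ has vertices the chambers and edges the homotopy classes $[\beta]$ of galleries, with $[\beta];[\beta']=[\beta\beta']$. Morphisms and coverings. A morphism of generalized chamber systems of type $M$ is a map on chambers and edges preserving extremities, types and inverses, with $\omega(i;i')=\omega(i);\omega(i')$ whenever $i,i'$ are composable of the same type and $i'\neq i^{-1}$. A morphism of Weyl data is such a morphism sending defining suites to suites. A morphism is surjective-étale if it is surjective on chambers and, for every chamber $C$, restricts to a bijection from the edges issuing from $C$ to the edges issuing from the image of $C$. A covering $p:\widetilde{\mathcal W}\to\mathcal W$ of Weyl data is a surjective-étale morphism of Weyl data such that every gallery $\beta$ of $\widetilde{\mathcal W}$ with $p\circ\beta$ a defining suite of $\mathcal W$ is a suite of $\widetilde{\mathcal W}$.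 A pre-Weyl graph is Weyl data satisfying (PW0) no panel is a trivial groupoid (one vertex, one edge), and (PW1) each maximal $(s,t)$-geodesic is homotopic to a maximal $(t,s)$-geodesic. A $2$-Weyl graph is a pre-Weyl graph satisfying (2W) homotopic alternating geodesics have the same $W$-length. A covering of groupoids is a surjective homomorphism $q:\widetilde{\mathcal G}\to\mathcal G$ such that for every vertex $\tilde x$ of $\widetilde{\mathcal G}$, $q$ restricts to a bijection from the edges issuing from $\tilde x$ to the edges issuing from $q(\tilde x)$. *)

theory Defs
  imports "HOL-Library.Extended_Nat"
begin

section \<open>Groupoids\<close>

record ('v, 'e) groupoid =
  verts :: "'v set"
  arrows :: "'e set"
  ini :: "'e \<Rightarrow> 'v"
  ter :: "'e \<Rightarrow> 'v"
  comp :: "'e \<Rightarrow> 'e \<Rightarrow> 'e"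
  ident :: "'v \<Rightarrow> 'e"
  inver :: "'e \<Rightarrow> 'e"

text \<open>Composition is written left to right: \<open>comp G g h\<close> is meaningful when
  \<open>ter G g = ini G h\<close>.\<close>

definition is_groupoid :: "('v, 'e) groupoid \<Rightarrow> bool" where
  "is_groupoid G \<longleftrightarrow>
     verts G \<noteq> {} \<and>
     (\<forall>g\<in>arrows G. ini G g \<in> verts G \<and> ter G g \<in> verts G) \<and>
     (\<forall>g\<in>arrows G. \<forall>h\<in>arrows G. ter G g = ini G h \<longrightarrow>
        comp G g h \<in> arrows G \<and> ini G (comp G g h) = ini G g \<and> ter G (comp G g h) = ter G h) \<and>
     (\<forall>g\<in>arrows G. \<forall>h\<in>arrows G. \<forall>k\<in>arrows G. ter G g = ini G h \<longrightarrow> ter G h = ini G k \<longrightarrow>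
        comp G (comp G g h) k = comp G g (comp G h k)) \<and>
     (\<forall>x\<in>verts G. ident G x \<in> arrows G \<and> ini G (ident G x) = x \<and> ter G (ident G x) = x) \<and>
     (\<forall>g\<in>arrows G. comp G (ident G (ini G g)) g = g \<and> comp G g (ident G (ter G g)) = g) \<and>
     (\<forall>g\<in>arrows G. inver G g \<in> arrows G \<and>
        ini G (inver G g) = ter G g \<and> ter G (inver G g) = ini G g \<and>
        comp G g (inver G g) = ident G (ini G g) \<and> comp G (inver G g) g = ident G (ter G g))"

definition arrows_from :: "('v, 'e) groupoid \<Rightarrow> 'v \<Rightarrow> 'e set" where
  "arrows_from G x = {g \<in> arrows G. ini G g = x}"

text \<open>The connected component of a vertex, as a groupoid.\<close>

definition component :: "('v, 'e) groupoid \<Rightarrow> 'v \<Rightarrow> ('v, 'e) groupoid" where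
  "component G x =
     (let K = {ter G g | g. g \<in> arrows_from G x}
      in G\<lparr>verts := K, arrows := {g \<in> arrows G. ini G g \<in> K \<and> ter G g \<in> K}\<rparr>)"

definition trivial_groupoid :: "('v, 'e) groupoid \<Rightarrow> bool" where
  "trivial_groupoid G \<longleftrightarrow> (\<exists>x. verts G = {x}) \<and> (\<exists>g. arrows G = {g})"

text \<open>A homomorphism is given by its vertex map and its edge map.\<close>

definition groupoid_hom ::
  "('v, 'e) groupoid \<Rightarrow> ('w, 'f) groupoid \<Rightarrow> ('v \<Rightarrow> 'w) \<times> ('e \<Rightarrow> 'f) \<Rightarrow> bool" where
  "groupoid_hom G H q \<longleftrightarrow>
     is_groupoid G \<and> is_groupoid H \<and>
     (\<forall>x\<in>verts G. fst q x \<in> verts H) \<and>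
     (\<forall>g\<in>arrows G. snd q g \<in> arrows H \<and>
        ini H (snd q g) = fst q (ini G g) \<and> ter H (snd q g) = fst q (ter G g)) \<and>
     (\<forall>g\<in>arrows G. \<forall>h\<in>arrows G. ter G g = ini G h \<longrightarrow>
        snd q (comp G g h) = comp H (snd q g) (snd q h))"

definition groupoid_covering ::
  "('v, 'e) groupoid \<Rightarrow> ('w, 'f) groupoid \<Rightarrow> ('v \<Rightarrow> 'w) \<times> ('e \<Rightarrow> 'f) \<Rightarrow> bool" where
  "groupoid_covering G H q \<longleftrightarrow>
     groupoid_hom G H q \<and>
     fst q ` verts G = verts H \<and> snd q ` arrows G = arrows H \<and>
     (\<forall>x\<in>verts G. bij_betw (snd q) (arrows_from G x) (arrows_from H (fst q x)))"


section \<open>Coxeter matrices and Coxeter groups\<close>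

record 's coxeter_matrix =
  gens :: "'s set"
  cox :: "'s \<Rightarrow> 's \<Rightarrow> enat"

definition is_coxeter_matrix :: "'s coxeter_matrix \<Rightarrow> bool" where
  "is_coxeter_matrix M \<longleftrightarrow>
     finite (gens M) \<and>
     (\<forall>s\<in>gens M. cox M s s = 1) \<and>
     (\<forall>s\<in>gens M. \<forall>t\<in>gens M. s \<noteq> t \<longrightarrow> cox M s t = cox M t s \<and> 2 \<le> cox M s t)"

text \<open>Elements of the Coxeter group are classes of group words: \<open>(s, True)\<close> is the generator
  \<open>s\<close> and \<open>(s, False)\<close> its formal inverse. Two group words are equivalent if they are related by
  insertions and deletions of \<open>x x\<inverse>\<close> and of the relators \<open>(st)^m\<close>; those with \<open>s = t\<close>
  are the relators \<open>s s\<close>.\<close>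

inductive coxeter_step ::
  "'s coxeter_matrix \<Rightarrow> ('s \<times> bool) list \<Rightarrow> ('s \<times> bool) list \<Rightarrow> bool" for M where
  free: "s \<in> gens M \<Longrightarrow> coxeter_step M (u @ [(s, b), (s, \<not> b)] @ v) (u @ v)"
| relator: "s \<in> gens M \<Longrightarrow> t \<in> gens M \<Longrightarrow> cox M s t = enat n \<Longrightarrow>
    coxeter_step M (u @ concat (replicate n [(s, True), (t, True)]) @ v) (u @ v)"

definition coxeter_class :: "'s coxeter_matrix \<Rightarrow> ('s \<times> bool) list \<Rightarrow> ('s \<times> bool) list set" where
  "coxeter_class M w = {v \<in> lists (gens M \<times> UNIV). equivclp (coxeter_step M) w v}"

definition coxeter_group :: "'s coxeter_matrix \<Rightarrow> ('s \<times> bool) list set set" where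
  "coxeter_group M = coxeter_class M ` lists (gens M \<times> UNIV)"

definition word_elt :: "'s coxeter_matrix \<Rightarrow> 's list \<Rightarrow> ('s \<times> bool) list set" where
  "word_elt M w = coxeter_class M (map (\<lambda>s. (s, True)) w)"

lemma word_elt_in_coxeter_group: "w \<in> lists (gens M) \<Longrightarrow> word_elt M w \<in> coxeter_group M"
  unfolding word_elt_def coxeter_group_def by (rule imageI) (auto simp: lists_eq_set)

definition reduced :: "'s coxeter_matrix \<Rightarrow> 's list \<Rightarrow> bool" where
  "reduced M w \<longleftrightarrow> w \<in> lists (gens M) \<and>
     \<not> (\<exists>v\<in>lists (gens M). length v < length w \<and> word_elt M v = word_elt M w)"

text \<open>\<open>alt_word n s t\<close> is \<open>stst\<cdots>\<close> with \<open>n\<close> letters.\<close>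

primrec alt_word :: "nat \<Rightarrow> 's \<Rightarrow> 's \<Rightarrow> 's list" where
  "alt_word 0 s t = []"
| "alt_word (Suc n) s t = s # alt_word n t s"

definition spherical_pair :: "'s coxeter_matrix \<Rightarrow> 's \<Rightarrow> 's \<Rightarrow> bool" where
  "spherical_pair M s t \<longleftrightarrow> s \<in> gens M \<and> t \<in> gens M \<and> s \<noteq> t \<and> cox M s t < \<infinity>"

definition fin_cox :: "'s coxeter_matrix \<Rightarrow> 's \<Rightarrow> 's \<Rightarrow> nat" where
  "fin_cox M s t = the_enat (cox M s t)"


section \<open>Generalized chamber systems and galleries\<close>

record ('s, 'c, 'e) chamber_system =
  chambers :: "'c set"
  panel_gpd :: "'s \<Rightarrow> ('c, 'e) groupoid"

text \<open>For a nonempty set of types the condition \<open>chambers W \<noteq> {}\<close> follows from the groupoids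
  being nonempty; for the empty set of types it has to be imposed for the fundamental groupoid to
  be nonempty.\<close>

definition is_chamber_system ::
  "'s coxeter_matrix \<Rightarrow> ('s, 'c, 'e, 'z) chamber_system_scheme \<Rightarrow> bool" where
  "is_chamber_system M W \<longleftrightarrow>
     chambers W \<noteq> {} \<and>
     (\<forall>s\<in>gens M. is_groupoid (panel_gpd W s) \<and> verts (panel_gpd W s) = chambers W)"

definition panels ::
  "('s, 'c, 'e, 'z) chamber_system_scheme \<Rightarrow> 's \<Rightarrow> ('c, 'e) groupoid set" where
  "panels W s = component (panel_gpd W s) ` chambers W"

text \<open>An edge is tagged with its type, so that edges of different types are distinct.\<close>

definition edges ::
  "'s coxeter_matrix \<Rightarrow> ('s, 'c, 'e, 'z) chamber_system_scheme \<Rightarrow> ('s \<times> 'e) set" where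
  "edges M W = {(s, g). s \<in> gens M \<and> g \<in> arrows (panel_gpd W s) \<and>
                        g \<notin> ident (panel_gpd W s) ` chambers W}"

definition e_ini :: "('s, 'c, 'e, 'z) chamber_system_scheme \<Rightarrow> 's \<times> 'e \<Rightarrow> 'c" where
  "e_ini W i = ini (panel_gpd W (fst i)) (snd i)"

definition e_ter :: "('s, 'c, 'e, 'z) chamber_system_scheme \<Rightarrow> 's \<times> 'e \<Rightarrow> 'c" where
  "e_ter W i = ter (panel_gpd W (fst i)) (snd i)"

definition e_inv :: "('s, 'c, 'e, 'z) chamber_system_scheme \<Rightarrow> 's \<times> 'e \<Rightarrow> 's \<times> 'e" where
  "e_inv W i = (fst i, inver (panel_gpd W (fst i)) (snd i))"

definition e_comp ::
  "('s, 'c, 'e, 'z) chamber_system_scheme \<Rightarrow> 's \<times> 'e \<Rightarrow> 's \<times> 'e \<Rightarrow> 's \<times> 'e" where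
  "e_comp W i j = (fst i, comp (panel_gpd W (fst i)) (snd i) (snd j))"

definition edges_from ::
  "'s coxeter_matrix \<Rightarrow> ('s, 'c, 'e, 'z) chamber_system_scheme \<Rightarrow> 'c \<Rightarrow> ('s \<times> 'e) set" where
  "edges_from M W C = {i \<in> edges M W. e_ini W i = C}"

text \<open>A gallery is recorded as its initial chamber and its list of edges.\<close>

type_synonym ('s, 'c, 'e) gallery = "'c \<times> ('s \<times> 'e) list"

primrec edge_path ::
  "'s coxeter_matrix \<Rightarrow> ('s, 'c, 'e, 'z) chamber_system_scheme \<Rightarrow> 'c \<Rightarrow> ('s \<times> 'e) list \<Rightarrow> bool" where
  "edge_path M W C [] \<longleftrightarrow> C \<in> chambers W"
| "edge_path M W C (i # js) \<longleftrightarrow> i \<in> edges M W \<and> e_ini W i = C \<and> edge_path M W (e_ter W i) js"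

definition is_gallery ::
  "'s coxeter_matrix \<Rightarrow> ('s, 'c, 'e, 'z) chamber_system_scheme \<Rightarrow> ('s, 'c, 'e) gallery \<Rightarrow> bool" where
  "is_gallery M W \<beta> \<longleftrightarrow> edge_path M W (fst \<beta>) (snd \<beta>)"

definition gal_ini :: "('s, 'c, 'e) gallery \<Rightarrow> 'c" where
  "gal_ini \<beta> = fst \<beta>"

definition gal_ter ::
  "('s, 'c, 'e, 'z) chamber_system_scheme \<Rightarrow> ('s, 'c, 'e) gallery \<Rightarrow> 'c" where
  "gal_ter W \<beta> = (if snd \<beta> = [] then fst \<beta> else e_ter W (last (snd \<beta>)))"

definition gal_append ::
  "('s, 'c, 'e) gallery \<Rightarrow> ('s, 'c, 'e) gallery \<Rightarrow> ('s, 'c, 'e) gallery" where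
  "gal_append \<beta> \<gamma> = (fst \<beta>, snd \<beta> @ snd \<gamma>)"

definition gal_inv ::
  "('s, 'c, 'e, 'z) chamber_system_scheme \<Rightarrow> ('s, 'c, 'e) gallery \<Rightarrow> ('s, 'c, 'e) gallery" where
  "gal_inv W \<beta> = (gal_ter W \<beta>, map (e_inv W) (rev (snd \<beta>)))"

definition gal_type :: "('s, 'c, 'e) gallery \<Rightarrow> 's list" where
  "gal_type \<beta> = map fst (snd \<beta>)"

definition W_length :: "'s coxeter_matrix \<Rightarrow> ('s, 'c, 'e) gallery \<Rightarrow> ('s \<times> bool) list set" where
  "W_length M \<beta> = word_elt M (gal_type \<beta>)"

definition is_cycle ::
  "'s coxeter_matrix \<Rightarrow> ('s, 'c, 'e, 'z) chamber_system_scheme \<Rightarrow> ('s, 'c, 'e) gallery \<Rightarrow> bool" where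
  "is_cycle M W \<beta> \<longleftrightarrow> is_gallery M W \<beta> \<and> gal_ini \<beta> = gal_ter W \<beta>"

definition geodesic ::
  "'s coxeter_matrix \<Rightarrow> ('s, 'c, 'e, 'z) chamber_system_scheme \<Rightarrow> ('s, 'c, 'e) gallery \<Rightarrow> bool" where
  "geodesic M W \<beta> \<longleftrightarrow> is_gallery M W \<beta> \<and> reduced M (gal_type \<beta>)"

definition st_geodesic ::
  "'s coxeter_matrix \<Rightarrow> ('s, 'c, 'e, 'z) chamber_system_scheme \<Rightarrow> 's \<Rightarrow> 's \<Rightarrow>
     ('s, 'c, 'e) gallery \<Rightarrow> bool" where
  "st_geodesic M W s t \<beta> \<longleftrightarrow>
     spherical_pair M s t \<and> geodesic M W \<beta> \<and> (\<exists>n. gal_type \<beta> = alt_word n s t)"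

definition max_st_geodesic ::
  "'s coxeter_matrix \<Rightarrow> ('s, 'c, 'e, 'z) chamber_system_scheme \<Rightarrow> 's \<Rightarrow> 's \<Rightarrow>
     ('s, 'c, 'e) gallery \<Rightarrow> bool" where
  "max_st_geodesic M W s t \<beta> \<longleftrightarrow>
     spherical_pair M s t \<and> is_gallery M W \<beta> \<and> gal_type \<beta> = alt_word (fin_cox M s t) s t"

definition st_cycle ::
  "'s coxeter_matrix \<Rightarrow> ('s, 'c, 'e, 'z) chamber_system_scheme \<Rightarrow> 's \<Rightarrow> 's \<Rightarrow>
     ('s, 'c, 'e) gallery \<Rightarrow> bool" where
  "st_cycle M W s t \<beta> \<longleftrightarrow>
     spherical_pair M s t \<and> is_cycle M W \<beta> \<and> gal_type \<beta> = alt_word (2 * fin_cox M s t) s t"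

definition alternating_geodesic ::
  "'s coxeter_matrix \<Rightarrow> ('s, 'c, 'e, 'z) chamber_system_scheme \<Rightarrow> ('s, 'c, 'e) gallery \<Rightarrow> bool" where
  "alternating_geodesic M W \<beta> \<longleftrightarrow>
     (\<exists>s t. st_geodesic M W s t \<beta>) \<or> (is_gallery M W \<beta> \<and> length (snd \<beta>) \<le> 1)"


section \<open>Weyl data and homotopy\<close>

record ('s, 'c, 'e) weyl_data = "('s, 'c, 'e) chamber_system" +
  suites_at :: "'s \<Rightarrow> 's \<Rightarrow> ('s, 'c, 'e) gallery set"

text \<open>Only the values of \<open>suites_at\<close> at spherical pairs are relevant.\<close>

definition is_weyl_data :: "'s coxeter_matrix \<Rightarrow> ('s, 'c, 'e) weyl_data \<Rightarrow> bool" where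
  "is_weyl_data M W \<longleftrightarrow>
     is_chamber_system M W \<and>
     (\<forall>s t. spherical_pair M s t \<longrightarrow> (\<forall>\<beta>\<in>suites_at W s t. st_cycle M W s t \<beta>))"

definition defining_suite ::
  "'s coxeter_matrix \<Rightarrow> ('s, 'c, 'e) weyl_data \<Rightarrow> ('s, 'c, 'e) gallery \<Rightarrow> bool" where
  "defining_suite M W \<beta> \<longleftrightarrow> (\<exists>s t. spherical_pair M s t \<and> \<beta> \<in> suites_at W s t)"

inductive elem_homotopy ::
  "'s coxeter_matrix \<Rightarrow> ('s, 'c, 'e) weyl_data \<Rightarrow>
     ('s, 'c, 'e) gallery \<Rightarrow> ('s, 'c, 'e) gallery \<Rightarrow> bool" for M W where
  cancel: "is_gallery M W (C, xs @ [i, e_inv W i] @ ys) \<Longrightarrow>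
    elem_homotopy M W (C, xs @ [i, e_inv W i] @ ys) (C, xs @ ys)"
| merge: "is_gallery M W (C, xs @ [i, j] @ ys) \<Longrightarrow> fst i = fst j \<Longrightarrow> j \<noteq> e_inv W i \<Longrightarrow>
    elem_homotopy M W (C, xs @ [i, j] @ ys) (C, xs @ [e_comp W i j] @ ys)"
| suite: "is_gallery M W (C, xs @ ds @ ys) \<Longrightarrow> defining_suite M W (gal_ter W (C, xs), ds) \<Longrightarrow>
    elem_homotopy M W (C, xs @ ds @ ys) (C, xs @ ys)"

definition homotopic ::
  "'s coxeter_matrix \<Rightarrow> ('s, 'c, 'e) weyl_data \<Rightarrow>
     ('s, 'c, 'e) gallery \<Rightarrow> ('s, 'c, 'e) gallery \<Rightarrow> bool" where
  "homotopic M W \<beta> \<gamma> \<longleftrightarrow>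
     is_gallery M W \<beta> \<and> is_gallery M W \<gamma> \<and> equivclp (elem_homotopy M W) \<beta> \<gamma>"

definition is_suite ::
  "'s coxeter_matrix \<Rightarrow> ('s, 'c, 'e) weyl_data \<Rightarrow> ('s, 'c, 'e) gallery \<Rightarrow> bool" where
  "is_suite M W \<beta> \<longleftrightarrow>
     (\<exists>s t. st_cycle M W s t \<beta>) \<and> (\<exists>C\<in>chambers W. homotopic M W \<beta> (C, []))"

definition hclass ::
  "'s coxeter_matrix \<Rightarrow> ('s, 'c, 'e) weyl_data \<Rightarrow>
     ('s, 'c, 'e) gallery \<Rightarrow> ('s, 'c, 'e) gallery set" where
  "hclass M W \<beta> = {\<gamma>. homotopic M W \<beta> \<gamma>}"

text \<open>Operations on classes are written as unions over representatives; as the operations do not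
  depend on the representatives, these are unions of a single class.\<close>

definition fundamental_groupoid ::
  "'s coxeter_matrix \<Rightarrow> ('s, 'c, 'e) weyl_data \<Rightarrow> ('c, ('s, 'c, 'e) gallery set) groupoid" where
  "fundamental_groupoid M W =
     \<lparr>verts = chambers W,
      arrows = {hclass M W \<beta> | \<beta>. is_gallery M W \<beta>},
      ini = (\<lambda>X. the_elem (gal_ini ` X)),
      ter = (\<lambda>X. the_elem (gal_ter W ` X)),
      comp = (\<lambda>X Y. \<Union>\<beta>\<in>X. \<Union>\<gamma>\<in>Y. hclass M W (gal_append \<beta> \<gamma>)),
      ident = (\<lambda>C. hclass M W (C, [])),
      inver = (\<lambda>X. \<Union>\<beta>\<in>X. hclass M W (gal_inv W \<beta>))\<rparr>"


section \<open>Morphisms, coverings and Weyl graphs\<close>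

text \<open>A morphism is given by its chamber map and its edge map.\<close>

type_synonym ('s, 'c, 'e, 'd, 'f) cs_map = "('c \<Rightarrow> 'd) \<times> ('s \<times> 'e \<Rightarrow> 's \<times> 'f)"

definition cs_morphism ::
  "'s coxeter_matrix \<Rightarrow> ('s, 'c, 'e, 'y) chamber_system_scheme \<Rightarrow>
     ('s, 'd, 'f, 'z) chamber_system_scheme \<Rightarrow> ('s, 'c, 'e, 'd, 'f) cs_map \<Rightarrow> bool" where
  "cs_morphism M V W p \<longleftrightarrow>
     is_chamber_system M V \<and> is_chamber_system M W \<and>
     (\<forall>C\<in>chambers V. fst p C \<in> chambers W) \<and>
     (\<forall>i\<in>edges M V. snd p i \<in> edges M W \<and>
        e_ini W (snd p i) = fst p (e_ini V i) \<and> e_ter W (snd p i) = fst p (e_ter V i) \<and>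
        fst (snd p i) = fst i \<and> snd p (e_inv V i) = e_inv W (snd p i)) \<and>
     (\<forall>i\<in>edges M V. \<forall>j\<in>edges M V.
        fst i = fst j \<longrightarrow> e_ter V i = e_ini V j \<longrightarrow> j \<noteq> e_inv V i \<longrightarrow>
        snd p (e_comp V i j) = e_comp W (snd p i) (snd p j))"

definition surjective_etale ::
  "'s coxeter_matrix \<Rightarrow> ('s, 'c, 'e, 'y) chamber_system_scheme \<Rightarrow>
     ('s, 'd, 'f, 'z) chamber_system_scheme \<Rightarrow> ('s, 'c, 'e, 'd, 'f) cs_map \<Rightarrow> bool" where
  "surjective_etale M V W p \<longleftrightarrow>
     cs_morphism M V W p \<and>
     fst p ` chambers V = chambers W \<and>
     (\<forall>C\<in>chambers V. bij_betw (snd p) (edges_from M V C) (edges_from M W (fst p C)))"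

definition map_gal ::
  "('s, 'c, 'e, 'd, 'f) cs_map \<Rightarrow> ('s, 'c, 'e) gallery \<Rightarrow> ('s, 'd, 'f) gallery" where
  "map_gal p \<beta> = (fst p (fst \<beta>), map (snd p) (snd \<beta>))"

definition weyl_morphism ::
  "'s coxeter_matrix \<Rightarrow> ('s, 'c, 'e) weyl_data \<Rightarrow> ('s, 'd, 'f) weyl_data \<Rightarrow>
     ('s, 'c, 'e, 'd, 'f) cs_map \<Rightarrow> bool" where
  "weyl_morphism M V W p \<longleftrightarrow>
     is_weyl_data M V \<and> is_weyl_data M W \<and> cs_morphism M V W p \<and>
     (\<forall>\<beta>. defining_suite M V \<beta> \<longrightarrow> is_suite M W (map_gal p \<beta>))"

definition weyl_covering ::
  "'s coxeter_matrix \<Rightarrow> ('s, 'c, 'e) weyl_data \<Rightarrow> ('s, 'd, 'f) weyl_data \<Rightarrow>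
     ('s, 'c, 'e, 'd, 'f) cs_map \<Rightarrow> bool" where
  "weyl_covering M V W p \<longleftrightarrow>
     weyl_morphism M V W p \<and> surjective_etale M V W p \<and>
     (\<forall>\<beta>. is_gallery M V \<beta> \<longrightarrow> defining_suite M W (map_gal p \<beta>) \<longrightarrow> is_suite M V \<beta>)"

definition pre_weyl_graph :: "'s coxeter_matrix \<Rightarrow> ('s, 'c, 'e) weyl_data \<Rightarrow> bool" where
  "pre_weyl_graph M W \<longleftrightarrow>
     is_weyl_data M W \<and>
     (\<forall>s\<in>gens M. \<forall>P\<in>panels W s. \<not> trivial_groupoid P) \<and>
     (\<forall>s t \<beta>. max_st_geodesic M W s t \<beta> \<longrightarrow>
        (\<exists>\<gamma>. max_st_geodesic M W t s \<gamma> \<and> homotopic M W \<beta> \<gamma>))"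

definition two_weyl_graph :: "'s coxeter_matrix \<Rightarrow> ('s, 'c, 'e) weyl_data \<Rightarrow> bool" where
  "two_weyl_graph M W \<longleftrightarrow>
     pre_weyl_graph M W \<and>
     (\<forall>\<beta> \<gamma>. alternating_geodesic M W \<beta> \<longrightarrow> alternating_geodesic M W \<gamma> \<longrightarrow>
        homotopic M W \<beta> \<gamma> \<longrightarrow> W_length M \<beta> = W_length M \<gamma>)"

definition induced_map ::
  "'s coxeter_matrix \<Rightarrow> ('s, 'd, 'f) weyl_data \<Rightarrow> ('s, 'c, 'e, 'd, 'f) cs_map \<Rightarrow>
     ('c \<Rightarrow> 'd) \<times> (('s, 'c, 'e) gallery set \<Rightarrow> ('s, 'd, 'f) gallery set)" where
  "induced_map M W p = (fst p, \<lambda>X. \<Union>\<beta>\<in>X. hclass M W (map_gal p \<beta>))"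

end

theory Submission
  imports Defs
begin

text \<open>A surjective-etale morphism has unique lifting of galleries. Each elementary homotopy of
  \<open>W\<close> lifts: a lift of \<open>i i\<inverse>\<close> has the form \<open>j j\<inverse>\<close> and a lift of a composable pair composes to
  the lift of its composite, both by uniqueness of lifts, and a lift of a defining suite is a suite
  by definition of a covering. So homotopies lift, and homotopic galleries have homotopic lifts from
  a common initial chamber, which is injectivity of the induced map on stars; surjectivity is lifting
  of galleries.\<close>

section \<open>Groupoids and edges\<close>

text \<open>Multiply on the left by \<open>inver G g\<close>. The vertex \<open>x\<close> is left
  free, though comparing endpoints forces it to be \<open>ini G g\<close>; so the lemma applies as
  soon as a composite is known to be some identity.\<close>

lemma groupoid_right_inverse_unique:
  assumes "is_groupoid G" "g \<in> arrows G" "h \<in> arrows G" "ter G g = ini G h"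
    and "comp G g h = ident G x" "x \<in> verts G"
  shows "h = inver G g"
proof -
  have x: "x = ini G g" "ter G h = ini G g"
    using assms unfolding is_groupoid_def by metis+
  have "h = comp G (comp G (inver G g) g) h"
    using assms unfolding is_groupoid_def by metis
  also have "\<dots> = comp G (inver G g) (comp G g h)"
    using assms unfolding is_groupoid_def by metis
  also have "\<dots> = inver G g"
    using assms x unfolding is_groupoid_def by metis
  finally show ?thesis .
qed

lemma groupoid_inver_inver:
  assumes "is_groupoid G" "g \<in> arrows G"
  shows "inver G (inver G g) = g"
proof -
  have "inver G g \<in> arrows G" "ter G (inver G g) = ini G g" "ter G g \<in> verts G"
    "comp G (inver G g) g = ident G (ter G g)"
    using assms unfolding is_groupoid_def by auto
  then show ?thesis
    using groupoid_right_inverse_unique[of G "inver G g" g] assms by metis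
qed

lemma groupoid_inver_ident:
  assumes "is_groupoid G" "x \<in> verts G"
  shows "inver G (ident G x) = ident G x"
proof -
  have "ident G x \<in> arrows G" "ini G (ident G x) = x" "ter G (ident G x) = x"
    using assms unfolding is_groupoid_def by auto
  moreover from this have "comp G (ident G x) (ident G x) = ident G x"
    using assms unfolding is_groupoid_def by metis
  ultimately show ?thesis
    using groupoid_right_inverse_unique[of G "ident G x" "ident G x" x] assms by simp
qed

locale weyl_data_on =
  fixes M :: "'s coxeter_matrix" and W :: "('s, 'c, 'e) weyl_data"
  assumes weyl_data: "is_weyl_data M W"
begin

lemma panel_groupoid:
  assumes "s \<in> gens M"
  shows "is_groupoid (panel_gpd W s)" "verts (panel_gpd W s) = chambers W"
  using assms weyl_data unfolding is_weyl_data_def is_chamber_system_def by auto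

lemma e_ini_chamber: "i \<in> edges M W \<Longrightarrow> e_ini W i \<in> chambers W"
  and e_ter_chamber: "i \<in> edges M W \<Longrightarrow> e_ter W i \<in> chambers W"
  using panel_groupoid[of "fst i"] unfolding edges_def e_ini_def e_ter_def is_groupoid_def by auto

text \<open>Edges are non-identity arrows, so the point to check is that inverting never produces an
  identity: inversion is an involution that fixes every identity.\<close>

lemma e_inv_edge:
  assumes "i \<in> edges M W"
  shows "e_inv W i \<in> edges M W" "e_ini W (e_inv W i) = e_ter W i"
    "e_ter W (e_inv W i) = e_ini W i" "e_inv W (e_inv W i) = i"
proof -
  obtain s g where i: "i = (s, g)" by fastforce
  have g: "s \<in> gens M" "g \<in> arrows (panel_gpd W s)"
    "g \<notin> ident (panel_gpd W s) ` chambers W"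
    using assms by (auto simp: i edges_def)
  note G = panel_groupoid[OF g(1)]
  have "inver (panel_gpd W s) g \<in> arrows (panel_gpd W s)"
    using G(1) g(2) unfolding is_groupoid_def by blast
  moreover have "inver (panel_gpd W s) g \<noteq> ident (panel_gpd W s) x" if "x \<in> chambers W" for x
    using groupoid_inver_inver[OF G(1) g(2)] groupoid_inver_ident[OF G(1), of x] G(2) g(3) that
    by auto
  ultimately show "e_inv W i \<in> edges M W"
    using g(1) by (auto simp: i edges_def e_inv_def)
  show "e_ini W (e_inv W i) = e_ter W i" "e_ter W (e_inv W i) = e_ini W i"
    using G(1) g(2) by (auto simp: i e_inv_def e_ini_def e_ter_def is_groupoid_def)
  show "e_inv W (e_inv W i) = i"
    using groupoid_inver_inver[OF G(1) g(2)] by (simp add: i e_inv_def)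
qed

text \<open>The condition \<open>j \<noteq> e_inv W i\<close> is what keeps the composite from being
  an identity, by uniqueness of right inverses. Hence merging two edges again yields an
  edge.\<close>

lemma e_comp_edge:
  assumes "i \<in> edges M W" "j \<in> edges M W" "fst i = fst j" "e_ter W i = e_ini W j"
    and "j \<noteq> e_inv W i"
  shows "e_comp W i j \<in> edges M W" "e_ini W (e_comp W i j) = e_ini W i"
    "e_ter W (e_comp W i j) = e_ter W j"
proof -
  obtain s g h where i: "i = (s, g)" and j: "j = (s, h)"
    using assms(3) by (metis prod.collapse)
  let ?G = "panel_gpd W s"
  have g: "s \<in> gens M" "g \<in> arrows ?G" "h \<in> arrows ?G"
    using assms by (auto simp: i j edges_def)
  have gh: "ter ?G g = ini ?G h"
    using assms(4) by (simp add: i j e_ter_def e_ini_def)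
  note G = panel_groupoid[OF g(1)]
  have *: "comp ?G g h \<in> arrows ?G" "ini ?G (comp ?G g h) = ini ?G g"
    "ter ?G (comp ?G g h) = ter ?G h"
    using G(1) g(2,3) gh unfolding is_groupoid_def by blast+
  have "comp ?G g h \<noteq> ident ?G x" if "x \<in> chambers W" for x
    using groupoid_right_inverse_unique[OF G(1) g(2,3) gh, of x] G(2) assms(5) that
    by (auto simp: i j e_inv_def)
  then show "e_comp W i j \<in> edges M W"
    using * g(1) by (auto simp: i j edges_def e_comp_def)
  show "e_ini W (e_comp W i j) = e_ini W i" "e_ter W (e_comp W i j) = e_ter W j"
    using * by (simp_all add: i j e_comp_def e_ini_def e_ter_def)
qed

section \<open>Galleries and homotopy\<close>

lemma gal_ter_Nil [simp]: "gal_ter W (C, []) = C"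
  by (simp add: gal_ter_def)

lemma gal_ter_Cons [simp]: "gal_ter W (C, i # xs) = gal_ter W (e_ter W i, xs)"
  by (simp add: gal_ter_def)

lemma gal_ter_append [simp]: "gal_ter W (C, xs @ ys) = gal_ter W (gal_ter W (C, xs), ys)"
  by (induction xs arbitrary: C) auto

lemma is_gallery_Pair [simp]: "is_gallery M W (C, xs) \<longleftrightarrow> edge_path M W C xs"
  by (simp add: is_gallery_def)

lemma edge_path_ini: "edge_path M W C xs \<Longrightarrow> C \<in> chambers W"
  by (cases xs) (auto simp: e_ini_chamber)

lemma edge_path_ter: "edge_path M W C xs \<Longrightarrow> gal_ter W (C, xs) \<in> chambers W"
  by (induction xs arbitrary: C) auto

lemma edge_path_append [simp]:
  "edge_path M W C (xs @ ys) \<longleftrightarrow> edge_path M W C xs \<and> edge_path M W (gal_ter W (C, xs)) ys"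
  by (induction xs arbitrary: C) (auto simp: edge_path_ini)

lemma defining_suite_cycle:
  "defining_suite M W (C, ds) \<Longrightarrow> edge_path M W C ds \<and> gal_ter W (C, ds) = C"
  using weyl_data
  unfolding defining_suite_def is_weyl_data_def st_cycle_def is_cycle_def gal_ini_def
  by fastforce

text \<open>The rules of \<open>elem_homotopy\<close> only require the longer side to be a gallery.
  That the shorter side is one too, with the same ends, follows from the facts on inverse and
  composite edges and from defining suites being cycles.\<close>

lemma elem_homotopy_endpoints:
  assumes "elem_homotopy M W \<beta> \<gamma>"
  shows "is_gallery M W \<beta> \<and> is_gallery M W \<gamma> \<and> fst \<gamma> = fst \<beta> \<and> gal_ter W \<gamma> = gal_ter W \<beta>"
  using assms
proof cases
  case (cancel C xs i ys)
  then show ?thesis by (auto simp: e_inv_edge)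
next
  case (merge C xs i j ys)
  then show ?thesis by (auto simp: e_comp_edge)
next
  case (suite C xs ds ys)
  then show ?thesis using defining_suite_cycle[OF suite(4)] by auto
qed

section \<open>Homotopy as an equivalence relation, stable under context\<close>

lemma homotopic_refl: "is_gallery M W \<beta> \<Longrightarrow> homotopic M W \<beta> \<beta>"
  by (simp add: homotopic_def)

lemma homotopic_sym: "homotopic M W \<beta> \<gamma> \<Longrightarrow> homotopic M W \<gamma> \<beta>"
  by (auto simp: homotopic_def intro: equivclp_sym)

lemma homotopic_trans [trans]:
  "homotopic M W \<beta> \<gamma> \<Longrightarrow> homotopic M W \<gamma> \<delta> \<Longrightarrow> homotopic M W \<beta> \<delta>"
  by (auto simp: homotopic_def intro: equivclp_trans)

lemma homotopic_elem: "elem_homotopy M W \<beta> \<gamma> \<Longrightarrow> homotopic M W \<beta> \<gamma>"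
  using elem_homotopy_endpoints by (auto simp: homotopic_def)

text \<open>Each step is a single move in either direction, and it remembers that the current
  gallery is homotopic to the starting one, so that its endpoints are known.\<close>

lemma homotopic_induct [consumes 1, case_names refl step]:
  assumes "homotopic M W \<beta> \<gamma>"
    and "P \<beta>"
    and "\<And>\<delta> \<epsilon>. homotopic M W \<beta> \<delta> \<Longrightarrow> elem_homotopy M W \<delta> \<epsilon> \<or> elem_homotopy M W \<epsilon> \<delta> \<Longrightarrow> P \<delta> \<Longrightarrow> P \<epsilon>"
  shows "P \<gamma>"
proof -
  have "equivclp (elem_homotopy M W) \<beta> \<gamma>" and \<beta>: "is_gallery M W \<beta>"
    using assms(1) by (auto simp: homotopic_def)
  then have "homotopic M W \<beta> \<gamma> \<and> P \<gamma>"
  proof (induction rule: equivclp_induct)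
    case base
    then show ?case using assms(2) homotopic_refl by simp
  next
    case (step \<delta> \<epsilon>)
    then show ?case
      using assms(3)[of \<delta> \<epsilon>] homotopic_elem homotopic_sym homotopic_trans by blast
  qed
  then show ?thesis ..
qed

lemma homotopic_endpoints:
  assumes "homotopic M W \<beta> \<gamma>"
  shows "is_gallery M W \<beta>" "is_gallery M W \<gamma>" "fst \<gamma> = fst \<beta>" "gal_ter W \<gamma> = gal_ter W \<beta>"
proof -
  show "is_gallery M W \<beta>" "is_gallery M W \<gamma>"
    using assms by (auto simp: homotopic_def)
  have "fst \<gamma> = fst \<beta> \<and> gal_ter W \<gamma> = gal_ter W \<beta>"
    using assms by (induction rule: homotopic_induct) (auto dest: elem_homotopy_endpoints)
  then show "fst \<gamma> = fst \<beta>" "gal_ter W \<gamma> = gal_ter W \<beta>" by auto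
qed

text \<open>Each rule already carries a prefix and a suffix, which absorb \<open>us\<close> and
  \<open>vs\<close>. In the suite case the base chamber stays the same because \<open>us\<close>
  ends where \<open>\<beta>\<close> begins.\<close>

lemma elem_homotopy_context:
  assumes "elem_homotopy M W \<beta> \<gamma>" "edge_path M W C (us @ snd \<beta> @ vs)"
    and "gal_ter W (C, us) = fst \<beta>"
  shows "elem_homotopy M W (C, us @ snd \<beta> @ vs) (C, us @ snd \<gamma> @ vs)"
  using assms(1)
proof cases
  case (cancel D xs i ys)
  then show ?thesis
    using elem_homotopy.cancel[of M W C "us @ xs" i "ys @ vs"] assms(2) by simp
next
  case (merge D xs i j ys)
  then show ?thesis
    using elem_homotopy.merge[of M W C "us @ xs" i j "ys @ vs"] assms(2) by simp
next
  case (suite D xs ds ys)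
  then show ?thesis
    using elem_homotopy.suite[of M W C "us @ xs" ds "ys @ vs"] assms(2,3) by simp
qed

lemma homotopic_context:
  assumes "homotopic M W \<beta> \<gamma>" "edge_path M W C (us @ snd \<beta> @ vs)"
    and "gal_ter W (C, us) = fst \<beta>"
  shows "homotopic M W (C, us @ snd \<beta> @ vs) (C, us @ snd \<gamma> @ vs)"
  using assms(1)
proof (induction rule: homotopic_induct)
  case refl
  then show ?case using assms(2) by (simp add: homotopic_refl)
next
  case (step \<delta> \<epsilon>)
  have *: "fst \<delta> = fst \<beta>" "fst \<epsilon> = fst \<beta>" "gal_ter W \<epsilon> = gal_ter W \<beta>" "is_gallery M W \<epsilon>"
    using step.hyps homotopic_endpoints[OF step.hyps(1)] elem_homotopy_endpoints by metis+
  have "gal_ter W (fst \<beta>, snd \<epsilon>) = gal_ter W (fst \<beta>, snd \<beta>)" "edge_path M W (fst \<beta>) (snd \<epsilon>)"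
    using * by (metis prod.collapse is_gallery_def)+
  \<comment> \<open>Moves fix both ends, so \<open>vs\<close> can still be attached after
    \<open>snd \<epsilon>\<close>. Both galleries in context must be known, since the move may go
    either way.\<close>
  then have "edge_path M W C (us @ snd \<epsilon> @ vs)"
    using assms(2,3) by auto
  moreover have "edge_path M W C (us @ snd \<delta> @ vs)"
    using homotopic_endpoints(2)[OF step.IH] by simp
  ultimately have "homotopic M W (C, us @ snd \<delta> @ vs) (C, us @ snd \<epsilon> @ vs)"
    using step.hyps(2) elem_homotopy_context[of \<delta> \<epsilon>] elem_homotopy_context[of \<epsilon> \<delta>] assms(3) *
      homotopic_elem homotopic_sym by metis
  then show ?case using step.IH homotopic_trans by blast
qed

text \<open>The moves delete only defining suites, whereas morphisms and coverings yield suites that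
  need not be defining. This lemma lets any suite be deleted inside a gallery.\<close>

lemma homotopic_suite:
  assumes "edge_path M W C (xs @ ds @ ys)" "is_suite M W (gal_ter W (C, xs), ds)"
  shows "homotopic M W (C, xs @ ds @ ys) (C, xs @ ys)"
proof -
  obtain D where D: "homotopic M W (gal_ter W (C, xs), ds) (D, [])"
    using assms(2) by (auto simp: is_suite_def)
  show ?thesis
    using homotopic_context[OF D, of C xs ys] assms(1) by simp
qed

section \<open>Concatenation and inversion of galleries up to homotopy\<close>

lemma gallery_append:
  assumes "is_gallery M W \<beta>" "is_gallery M W \<gamma>" "gal_ter W \<beta> = fst \<gamma>"
  shows "is_gallery M W (gal_append \<beta> \<gamma>)" "fst (gal_append \<beta> \<gamma>) = fst \<beta>"
    "gal_ter W (gal_append \<beta> \<gamma>) = gal_ter W \<gamma>"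
  using assms by (cases \<beta>; cases \<gamma>; simp add: gal_append_def)+

text \<open>Change the first factor, then the second. Equality of endpoints of homotopic galleries
  keeps the intermediate gallery composable.\<close>

lemma homotopic_append:
  assumes "homotopic M W \<beta> \<beta>'" "homotopic M W \<gamma> \<gamma>'" "gal_ter W \<beta> = fst \<gamma>"
  shows "homotopic M W (gal_append \<beta> \<gamma>) (gal_append \<beta>' \<gamma>')"
proof -
  note \<beta> = homotopic_endpoints[OF assms(1)] and \<gamma> = homotopic_endpoints[OF assms(2)]
  have "homotopic M W (fst \<beta>, [] @ snd \<beta> @ snd \<gamma>) (fst \<beta>, [] @ snd \<beta>' @ snd \<gamma>)"
    using gallery_append(1)[OF \<beta>(1) \<gamma>(1) assms(3)]
    by (intro homotopic_context[OF assms(1)]) (auto simp: gal_append_def)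
  moreover have "homotopic M W (fst \<beta>, snd \<beta>' @ snd \<gamma> @ []) (fst \<beta>, snd \<beta>' @ snd \<gamma>' @ [])"
    using gallery_append(1)[OF \<beta>(2) \<gamma>(1)] \<beta>(3,4) assms(3)
    by (intro homotopic_context[OF assms(2)]) (auto simp: gal_append_def gal_ter_def)
  ultimately show ?thesis
    using \<beta>(3) by (auto simp: gal_append_def intro: homotopic_trans)
qed

lemma gal_inv_Cons:
  "gal_inv W (C, i # xs) = (gal_ter W (C, i # xs), snd (gal_inv W (e_ter W i, xs)) @ [e_inv W i])"
  by (simp add: gal_inv_def)

lemma gallery_inv:
  assumes "is_gallery M W \<beta>"
  shows "is_gallery M W (gal_inv W \<beta>)" "fst (gal_inv W \<beta>) = gal_ter W \<beta>"
    "gal_ter W (gal_inv W \<beta>) = fst \<beta>"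
proof -
  have "edge_path M W C xs \<Longrightarrow> is_gallery M W (gal_inv W (C, xs)) \<and>
      gal_ter W (gal_inv W (C, xs)) = C" for C xs
  proof (induction xs arbitrary: C)
    case Nil
    then show ?case by (simp add: gal_inv_def)
  next
    case (Cons i xs)
    then show ?case
      using Cons.IH[of "e_ter W i"] e_inv_edge[of i] e_ini_chamber[of i]
      by (simp add: gal_inv_def)
  qed
  then show "is_gallery M W (gal_inv W \<beta>)" "gal_ter W (gal_inv W \<beta>) = fst \<beta>"
    using assms by (cases \<beta>; simp)+
  show "fst (gal_inv W \<beta>) = gal_ter W \<beta>"
    by (simp add: gal_inv_def)
qed

lemma gal_inv_inv: "is_gallery M W \<beta> \<Longrightarrow> gal_inv W (gal_inv W \<beta>) = \<beta>"
proof -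
  assume \<beta>: "is_gallery M W \<beta>"
  have "edge_path M W C xs \<Longrightarrow> map (e_inv W \<circ> e_inv W) xs = xs" for C xs
    by (induction xs arbitrary: C) (auto simp: e_inv_edge)
  then have "snd (gal_inv W (gal_inv W \<beta>)) = snd \<beta>"
    using \<beta> by (cases \<beta>) (simp add: gal_inv_def rev_map)
  moreover have "fst (gal_inv W (gal_inv W \<beta>)) = fst \<beta>"
    using gallery_inv(3)[OF \<beta>] by (simp add: gal_inv_def)
  ultimately show ?thesis by (simp add: prod_eq_iff)
qed

text \<open>Cancel from the middle outwards: the induction hypothesis contracts everything between
  the outermost edge and its inverse, and one \<open>cancel\<close> move removes that pair.\<close>

lemma homotopic_append_inv:
  assumes "is_gallery M W \<beta>"
  shows "homotopic M W (gal_append \<beta> (gal_inv W \<beta>)) (fst \<beta>, [])"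
proof -
  have "edge_path M W C xs \<Longrightarrow> homotopic M W (C, xs @ snd (gal_inv W (C, xs))) (C, [])" for C xs
  proof (induction xs arbitrary: C)
    case Nil
    then show ?case by (simp add: gal_inv_def homotopic_refl)
  next
    case (Cons i xs)
    let ?ys = "xs @ snd (gal_inv W (e_ter W i, xs))"
    have i: "i \<in> edges M W" "e_ini W i = C" "C \<in> chambers W"
      using Cons.prems e_ini_chamber[of i] by simp_all
    have IH: "homotopic M W (e_ter W i, ?ys) (e_ter W i, [])"
      using Cons by simp
    note ends = homotopic_endpoints[OF IH]
    have "homotopic M W (C, [i] @ ?ys @ [e_inv W i]) (C, [i] @ [] @ [e_inv W i])"
      using homotopic_context[OF IH, of C "[i]" "[e_inv W i]"] ends i e_inv_edge[OF i(1)] by simp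
    moreover have "homotopic M W (C, [i, e_inv W i]) (C, [])"
      using homotopic_elem[OF elem_homotopy.cancel[of M W C "[]" i "[]"]] i e_inv_edge[OF i(1)]
      by simp
    ultimately show ?case
      by (auto simp: gal_inv_Cons intro: homotopic_trans)
  qed
  then show ?thesis
    using assms by (cases \<beta>) (simp add: gal_append_def)
qed

lemma homotopic_inv_append:
  assumes "is_gallery M W \<beta>"
  shows "homotopic M W (gal_append (gal_inv W \<beta>) \<beta>) (gal_ter W \<beta>, [])"
  using homotopic_append_inv[OF gallery_inv(1)[OF assms]] gal_inv_inv[OF assms]
    gallery_inv(2)[OF assms] by simp

lemma gal_append_assoc: "gal_append (gal_append \<beta> \<gamma>) \<delta> = gal_append \<beta> (gal_append \<gamma> \<delta>)"
  by (simp add: gal_append_def)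

lemma gal_append_trivial [simp]: "gal_append \<beta> (C, []) = \<beta>" "gal_append (fst \<beta>, []) \<beta> = \<beta>"
  by (simp_all add: gal_append_def)

text \<open>This is the uniqueness of inverses in a groupoid, as the chain \<open>b\<close>,
  \<open>b \<gamma> c\<close>, \<open>b \<beta> c\<close>, \<open>c\<close> with \<open>b\<close>,
  \<open>c\<close> the inverse galleries. Reversing the moves one by one would meet reversed
  defining suites, which need not be defining suites.\<close>

lemma homotopic_inv:
  assumes "homotopic M W \<beta> \<gamma>"
  shows "homotopic M W (gal_inv W \<beta>) (gal_inv W \<gamma>)"
proof -
  note e = homotopic_endpoints[OF assms]
  note \<beta>' = gallery_inv[OF e(1)] and \<gamma>' = gallery_inv[OF e(2)]
  let ?b = "gal_inv W \<beta>" and ?c = "gal_inv W \<gamma>"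
  have "homotopic M W (gal_append \<gamma> ?c) (fst \<beta>, [])"
    using homotopic_append_inv[OF e(2)] e(3) by simp
  from homotopic_append[OF homotopic_refl[OF \<beta>'(1)] homotopic_sym[OF this]]
  have "homotopic M W ?b (gal_append ?b (gal_append \<gamma> ?c))"
    using \<beta>' by simp
  also have "homotopic M W (gal_append ?b (gal_append \<gamma> ?c)) (gal_append (gal_append ?b \<beta>) ?c)"
    unfolding gal_append_assoc
    using homotopic_append[OF homotopic_refl[OF \<beta>'(1)]
        homotopic_append[OF homotopic_sym[OF assms] homotopic_refl[OF \<gamma>'(1)]]] \<beta>' \<gamma>' e
      gallery_append(2) by (simp add: gal_append_def)
  also have "homotopic M W (gal_append (gal_append ?b \<beta>) ?c) (gal_append (fst ?c, []) ?c)"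
    using homotopic_append[OF homotopic_inv_append[OF e(1)] homotopic_refl[OF \<gamma>'(1)]] \<gamma>' e
      gallery_append(3)[OF \<beta>'(1) e(1) \<beta>'(3)] by simp
  finally show ?thesis by simp
qed

section \<open>The fundamental groupoid\<close>

text \<open>The gallery assumption matters: the class of a non-gallery is empty, so two
  non-galleries have equal classes without being homotopic.\<close>

lemma hclass_eq_iff:
  assumes "is_gallery M W \<beta>"
  shows "hclass M W \<beta> = hclass M W \<gamma> \<longleftrightarrow> homotopic M W \<beta> \<gamma>"
proof
  assume "hclass M W \<beta> = hclass M W \<gamma>"
  then show "homotopic M W \<beta> \<gamma>"
    using homotopic_refl[OF assms] homotopic_sym unfolding hclass_def by blast
next
  assume "homotopic M W \<beta> \<gamma>"
  then show "hclass M W \<beta> = hclass M W \<gamma>"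
    using homotopic_sym homotopic_trans unfolding hclass_def by blast
qed

text \<open>The operations of \<open>fundamental_groupoid\<close> are written with
  \<open>the_elem\<close> of an image or with a union over a class. A singleton image evaluates
  either form on a representative.\<close>

lemma image_hclass_const:
  assumes "is_gallery M W \<beta>" "\<And>\<gamma>. homotopic M W \<beta> \<gamma> \<Longrightarrow> f \<gamma> = f \<beta>"
  shows "f ` hclass M W \<beta> = {f \<beta>}"
  using assms homotopic_refl unfolding hclass_def by blast

lemma fundamental_groupoid_simps:
  assumes "is_gallery M W \<beta>"
  shows "ini (fundamental_groupoid M W) (hclass M W \<beta>) = fst \<beta>"
    and "ter (fundamental_groupoid M W) (hclass M W \<beta>) = gal_ter W \<beta>"
    and "inver (fundamental_groupoid M W) (hclass M W \<beta>) = hclass M W (gal_inv W \<beta>)"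
proof -
  have "gal_ini ` hclass M W \<beta> = {fst \<beta>}"
    using image_hclass_const[OF assms, of gal_ini] homotopic_endpoints(3) by (simp add: gal_ini_def)
  then show "ini (fundamental_groupoid M W) (hclass M W \<beta>) = fst \<beta>"
    by (simp add: fundamental_groupoid_def)
  have "gal_ter W ` hclass M W \<beta> = {gal_ter W \<beta>}"
    using image_hclass_const[OF assms, of "gal_ter W"] homotopic_endpoints(4) by simp
  then show "ter (fundamental_groupoid M W) (hclass M W \<beta>) = gal_ter W \<beta>"
    by (simp add: fundamental_groupoid_def)
  have "hclass M W (gal_inv W \<gamma>) = hclass M W (gal_inv W \<beta>)" if "homotopic M W \<beta> \<gamma>" for \<gamma>
    using homotopic_inv[OF that] hclass_eq_iff gallery_inv(1)[OF assms] by metis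
  then have "(\<lambda>\<gamma>. hclass M W (gal_inv W \<gamma>)) ` hclass M W \<beta> = {hclass M W (gal_inv W \<beta>)}"
    by (rule image_hclass_const[OF assms])
  then show "inver (fundamental_groupoid M W) (hclass M W \<beta>) = hclass M W (gal_inv W \<beta>)"
    by (simp add: fundamental_groupoid_def)
qed

lemma fundamental_groupoid_comp:
  assumes "is_gallery M W \<beta>" "is_gallery M W \<gamma>" "gal_ter W \<beta> = fst \<gamma>"
  shows "comp (fundamental_groupoid M W) (hclass M W \<beta>) (hclass M W \<gamma>) =
    hclass M W (gal_append \<beta> \<gamma>)"
proof -
  have *: "hclass M W (gal_append \<beta>' \<gamma>') = hclass M W (gal_append \<beta> \<gamma>)"
    if "\<beta>' \<in> hclass M W \<beta>" "\<gamma>' \<in> hclass M W \<gamma>" for \<beta>' \<gamma>'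
    using that homotopic_append[of \<beta> \<beta>' \<gamma> \<gamma>'] assms(3)
      hclass_eq_iff[OF gallery_append(1)[OF assms], of "gal_append \<beta>' \<gamma>'"]
    by (simp add: hclass_def)
  have "\<beta> \<in> hclass M W \<beta>" "\<gamma> \<in> hclass M W \<gamma>"
    using assms homotopic_refl by (auto simp: hclass_def)
  then have "(\<Union>\<beta>'\<in>hclass M W \<beta>. \<Union>\<gamma>'\<in>hclass M W \<gamma>. hclass M W (gal_append \<beta>' \<gamma>')) =
      hclass M W (gal_append \<beta> \<gamma>)"
    using * by blast
  then show ?thesis
    by (simp add: fundamental_groupoid_def)
qed

lemma fundamental_groupoid_verts: "verts (fundamental_groupoid M W) = chambers W"
  and fundamental_groupoid_ident: "ident (fundamental_groupoid M W) C = hclass M W (C, [])"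
  by (simp_all add: fundamental_groupoid_def)

lemma fundamental_groupoid_arrows:
  "arrows (fundamental_groupoid M W) = {hclass M W \<beta> | \<beta>. is_gallery M W \<beta>}"
  by (simp only: fundamental_groupoid_def groupoid.simps)

lemma hclass_arrow: "is_gallery M W \<beta> \<Longrightarrow> hclass M W \<beta> \<in> arrows (fundamental_groupoid M W)"
  unfolding fundamental_groupoid_arrows by blast

lemma fundamental_groupoid_arrowE:
  assumes "X \<in> arrows (fundamental_groupoid M W)"
  obtains \<beta> where "is_gallery M W \<beta>" "X = hclass M W \<beta>"
  using assms unfolding fundamental_groupoid_arrows by blast

text \<open>Homotopic galleries share their initial chamber, so a star of the fundamental groupoid
  can be described by galleries, to which lifting applies.\<close>

lemma arrows_from_fundamental_groupoid:
  "arrows_from (fundamental_groupoid M W) C = {hclass M W \<beta> | \<beta>. is_gallery M W \<beta> \<and> fst \<beta> = C}"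
proof (intro subset_antisym subsetI)
  fix X assume X: "X \<in> arrows_from (fundamental_groupoid M W) C"
  then have "X \<in> arrows (fundamental_groupoid M W)"
    by (simp add: arrows_from_def)
  then obtain \<beta> where \<beta>: "is_gallery M W \<beta>" "X = hclass M W \<beta>"
    by (rule fundamental_groupoid_arrowE)
  with X have "fst \<beta> = C"
    by (simp add: arrows_from_def fundamental_groupoid_simps(1))
  with \<beta> show "X \<in> {hclass M W \<beta> | \<beta>. is_gallery M W \<beta> \<and> fst \<beta> = C}"
    by blast
next
  fix X assume "X \<in> {hclass M W \<beta> | \<beta>. is_gallery M W \<beta> \<and> fst \<beta> = C}"
  then obtain \<beta> where "is_gallery M W \<beta>" "fst \<beta> = C" "X = hclass M W \<beta>" by blast
  then show "X \<in> arrows_from (fundamental_groupoid M W) C"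
    by (simp add: arrows_from_def fundamental_groupoid_simps(1) hclass_arrow)
qed

lemma gallery_chambers:
  "is_gallery M W \<beta> \<Longrightarrow> fst \<beta> \<in> chambers W" "is_gallery M W \<beta> \<Longrightarrow> gal_ter W \<beta> \<in> chambers W"
  by (cases \<beta>; simp add: edge_path_ini edge_path_ter)+

lemma is_groupoid_fundamental_groupoid: "is_groupoid (fundamental_groupoid M W)"
  unfolding is_groupoid_def
proof (intro conjI ballI impI)
  show "verts (fundamental_groupoid M W) \<noteq> {}"
    using weyl_data by (simp add: fundamental_groupoid_verts is_weyl_data_def is_chamber_system_def)
\<comment> \<open>The other axioms are checked on representatives. Associativity and the unit laws
  hold for galleries on the nose; only the inverse laws use homotopies.\<close>
qed ((elim fundamental_groupoid_arrowE)?,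
    simp add: fundamental_groupoid_verts fundamental_groupoid_ident hclass_arrow
      fundamental_groupoid_simps fundamental_groupoid_comp gallery_append gallery_inv
      gallery_chambers gal_append_assoc hclass_eq_iff homotopic_append_inv homotopic_inv_append)+

end

section \<open>Lifting along a covering\<close>

lemma map_eq_appendE:
  assumes "map f zs = xs @ ys"
  obtains us vs where "zs = us @ vs" "map f us = xs" "map f vs = ys"
  using assms by (auto simp: map_eq_append_conv)

lemma map_eq_pairE:
  assumes "map f xs = [i, j]"
  obtains a b where "xs = [a, b]" "f a = i" "f b = j"
  using assms by (auto simp: map_eq_Cons_conv)

locale weyl_covering_of =
  V: weyl_data_on M V + W: weyl_data_on M W
  for M :: "'s coxeter_matrix" and V :: "('s, 'c, 'e) weyl_data" and W :: "('s, 'd, 'f) weyl_data" +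
  fixes p :: "('s, 'c, 'e, 'd, 'f) cs_map"
  assumes covering: "weyl_covering M V W p"
begin

section \<open>Unique lifting of edges and galleries\<close>

lemma edge_map:
  assumes "i \<in> edges M V"
  shows "snd p i \<in> edges M W" "e_ini W (snd p i) = fst p (e_ini V i)"
    "e_ter W (snd p i) = fst p (e_ter V i)" "fst (snd p i) = fst i"
    "snd p (e_inv V i) = e_inv W (snd p i)"
  using assms covering unfolding weyl_covering_def weyl_morphism_def cs_morphism_def by auto

lemma chamber_map: "C \<in> chambers V \<Longrightarrow> fst p C \<in> chambers W"
  using covering unfolding weyl_covering_def weyl_morphism_def cs_morphism_def by auto

lemma chamber_map_image: "fst p ` chambers V = chambers W"
  using covering unfolding weyl_covering_def surjective_etale_def by auto

lemma edge_map_comp: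
  assumes "i \<in> edges M V" "j \<in> edges M V" "fst i = fst j" "e_ter V i = e_ini V j" "j \<noteq> e_inv V i"
  shows "snd p (e_comp V i j) = e_comp W (snd p i) (snd p j)"
  using assms covering unfolding weyl_covering_def weyl_morphism_def cs_morphism_def by auto

lemma star_bij:
  "C \<in> chambers V \<Longrightarrow> bij_betw (snd p) (edges_from M V C) (edges_from M W (fst p C))"
  using covering unfolding weyl_covering_def surjective_etale_def by auto

lemma edge_map_inj:
  assumes "i \<in> edges M V" "j \<in> edges M V" "e_ini V i = e_ini V j" "snd p i = snd p j"
  shows "i = j"
proof -
  have "inj_on (snd p) (edges_from M V (e_ini V i))"
    using star_bij[OF V.e_ini_chamber[OF assms(1)]] by (simp add: bij_betw_def)
  then show ?thesis
    by (rule inj_onD) (use assms in \<open>simp_all add: edges_from_def\<close>)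
qed

lemma edge_lift:
  assumes "C \<in> chambers V" "k \<in> edges M W" "e_ini W k = fst p C"
  obtains i where "i \<in> edges M V" "e_ini V i = C" "snd p i = k"
proof -
  have "k \<in> snd p ` edges_from M V C"
    using assms star_bij[OF assms(1)] by (simp add: bij_betw_def edges_from_def)
  then show thesis using that by (auto simp: edges_from_def)
qed

lemma edge_path_map:
  assumes "edge_path M V C xs"
  shows "edge_path M W (fst p C) (map (snd p) xs)"
    "gal_ter W (fst p C, map (snd p) xs) = fst p (gal_ter V (C, xs))"
  using assms by (induction xs arbitrary: C) (auto simp: edge_map chamber_map)

lemma gallery_map:
  assumes "is_gallery M V \<beta>"
  shows "is_gallery M W (map_gal p \<beta>)" "gal_ter W (map_gal p \<beta>) = fst p (gal_ter V \<beta>)"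
  using assms edge_path_map[of "fst \<beta>" "snd \<beta>"] by (auto simp: map_gal_def is_gallery_def)

text \<open>Lifts are unique edge by edge: injectivity on the star of \<open>C\<close> makes the
  first edges equal, so the remaining paths start at the same chamber.\<close>

lemma edge_path_map_inj:
  "edge_path M V C xs \<Longrightarrow> edge_path M V C ys \<Longrightarrow> map (snd p) xs = map (snd p) ys \<Longrightarrow> xs = ys"
proof (induction xs arbitrary: C ys)
  case (Cons i xs)
  then obtain j zs where ys: "ys = j # zs" by (cases ys) auto
  with Cons.prems edge_map_inj[of i j] have "i = j" by auto
  with Cons ys show ?case by auto
qed auto

lemma gallery_map_inj:
  assumes "is_gallery M V \<beta>" "is_gallery M V \<gamma>" "fst \<beta> = fst \<gamma>" "map_gal p \<beta> = map_gal p \<gamma>"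
  shows "\<beta> = \<gamma>"
  using assms edge_path_map_inj[of "fst \<beta>" "snd \<beta>" "snd \<gamma>"]
  by (simp add: map_gal_def is_gallery_def prod_eq_iff)

lemma edge_path_lift:
  assumes "C \<in> chambers V" "edge_path M W (fst p C) ks"
  obtains xs where "edge_path M V C xs" "map (snd p) xs = ks"
proof -
  have "\<exists>xs. edge_path M V C xs \<and> map (snd p) xs = ks"
    using assms
  proof (induction ks arbitrary: C)
    case (Cons k ks)
    from Cons.prems have "C \<in> chambers V" "k \<in> edges M W" "e_ini W k = fst p C" by simp_all
    then obtain i where i: "i \<in> edges M V" "e_ini V i = C" "snd p i = k"
      by (rule edge_lift)
    \<comment> \<open>The end of the lifted edge lies over the end of \<open>k\<close>, so the rest
      of the path can be lifted from there.\<close>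
    then obtain xs where "edge_path M V (e_ter V i) xs" "map (snd p) xs = ks"
      using Cons.IH[of "e_ter V i"] Cons.prems edge_map(3)[OF i(1)] V.e_ter_chamber by auto
    with i show ?case by (intro exI[of _ "i # xs"]) simp
  qed auto
  then show thesis using that by blast
qed

lemma gallery_lift:
  assumes "is_gallery M W \<gamma>" "C \<in> chambers V" "fst p C = fst \<gamma>"
  obtains \<beta> where "is_gallery M V \<beta>" "fst \<beta> = C" "map_gal p \<beta> = \<gamma>"
proof -
  obtain xs where "edge_path M V C xs" "map (snd p) xs = snd \<gamma>"
    using assms edge_path_lift[of C "snd \<gamma>"] by (auto simp: is_gallery_def)
  then show thesis
    using that[of "(C, xs)"] assms(3) by (auto simp: map_gal_def)
qed

section \<open>Mapping and lifting homotopies\<close>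

lemma e_inv_map_iff:
  assumes "i \<in> edges M V" "j \<in> edges M V" "e_ter V i = e_ini V j"
  shows "snd p j = e_inv W (snd p i) \<longleftrightarrow> j = e_inv V i"
  \<comment> \<open>Both \<open>j\<close> and \<open>e_inv V i\<close> issue from
    \<open>e_ter V i\<close>, so equality of their images gives equality of the edges.\<close>
  using assms edge_map_inj[of j "e_inv V i"] edge_map(5)[of i] V.e_inv_edge[of i] by auto

text \<open>The conclusion is \<open>homotopic\<close> rather than a single move because a defining
  suite is only mapped to a suite. In the merge case, \<open>e_inv_map_iff\<close> shows that the
  image pair is again not mutually inverse.\<close>

lemma homotopic_map_elem:
  assumes "elem_homotopy M V \<beta> \<gamma>"
  shows "homotopic M W (map_gal p \<beta>) (map_gal p \<gamma>)"
  using assms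
proof cases
  case (cancel C xs i ys)
  have "is_gallery M W (map_gal p \<beta>)"
    using cancel gallery_map(1) by blast
  then show ?thesis
    using cancel edge_map(5)[of i]
      W.homotopic_elem[OF elem_homotopy.cancel[of M W "fst p C" "map (snd p) xs" "snd p i" "map (snd p) ys"]]
    by (simp add: map_gal_def)
next
  case (merge C xs i j ys)
  have "is_gallery M W (map_gal p \<beta>)"
    using merge gallery_map(1) by blast
  then show ?thesis
    using merge edge_map_comp[of i j] e_inv_map_iff[of i j] edge_map(4)[of i] edge_map(4)[of j]
      W.homotopic_elem[OF elem_homotopy.merge[of M W "fst p C" "map (snd p) xs" "snd p i" "snd p j" "map (snd p) ys"]]
    by (simp add: map_gal_def)
next
  case (suite C xs ds ys)
  have "edge_path M W (fst p C) (map (snd p) (xs @ ds @ ys))"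
    using suite edge_path_map(1)[of C "xs @ ds @ ys"] by simp
  moreover have "is_suite M W (map_gal p (gal_ter V (C, xs), ds))"
    using suite(4) covering unfolding weyl_covering_def weyl_morphism_def by blast
  moreover have "fst p (gal_ter V (C, xs)) = gal_ter W (fst p C, map (snd p) xs)"
    using suite edge_path_map(2)[of C xs] by simp
  ultimately show ?thesis
    using W.homotopic_suite[of "fst p C" "map (snd p) xs" "map (snd p) ds" "map (snd p) ys"] suite
    by (simp add: map_gal_def)
qed

lemma homotopic_map:
  assumes "homotopic M V \<beta> \<gamma>"
  shows "homotopic M W (map_gal p \<beta>) (map_gal p \<gamma>)"
  using assms
proof (induction rule: V.homotopic_induct)
  case refl
  then show ?case
    using V.homotopic_endpoints(1)[OF assms] by (intro W.homotopic_refl gallery_map)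
next
  case (step \<delta> \<epsilon>)
  then show ?case
    using homotopic_map_elem W.homotopic_sym W.homotopic_trans by blast
qed

lemma map_gal_append3E:
  assumes "map_gal p \<beta> = (D, xs @ ks @ ys)" "fst \<beta> = C"
  obtains us es vs where "\<beta> = (C, us @ es @ vs)" "map (snd p) us = xs"
    "map (snd p) es = ks" "map (snd p) vs = ys"
proof -
  have "map (snd p) (snd \<beta>) = xs @ ks @ ys"
    using assms(1) by (simp add: map_gal_def)
  then obtain us zs where us: "snd \<beta> = us @ zs" "map (snd p) us = xs" "map (snd p) zs = ks @ ys"
    by (rule map_eq_appendE)
  obtain es vs where es: "zs = es @ vs" "map (snd p) es = ks" "map (snd p) vs = ys"
    using us(3) by (rule map_eq_appendE)
  have "\<beta> = (C, us @ es @ vs)"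
    using us(1) es(1) assms(2) by (simp add: prod_eq_iff)
  then show thesis
    using us(2) es(2,3) by (rule that)
qed

text \<open>Producing both lifts at once makes the statement symmetric, so that it also serves for
  inverse elementary homotopies.\<close>

lemma elem_homotopy_lift:
  assumes "elem_homotopy M W \<gamma> \<delta>" "C \<in> chambers V" "fst p C = fst \<gamma>"
  shows "\<exists>\<beta> \<beta>'. homotopic M V \<beta> \<beta>' \<and> fst \<beta> = C \<and> map_gal p \<beta> = \<gamma> \<and> map_gal p \<beta>' = \<delta>"
proof -
  have "is_gallery M W \<gamma>"
    using assms(1) W.elem_homotopy_endpoints by blast
  then obtain \<beta> where \<beta>: "is_gallery M V \<beta>" "fst \<beta> = C" "map_gal p \<beta> = \<gamma>"
    using gallery_lift assms(2,3) by blast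
  have "\<exists>\<beta>'. homotopic M V \<beta> \<beta>' \<and> map_gal p \<beta>' = \<delta>"
    using assms(1)
  proof cases
    case (cancel D xs i ys)
    obtain us es vs where es: "\<beta> = (C, us @ es @ vs)" "map (snd p) us = xs"
      "map (snd p) es = [i, e_inv W i]" "map (snd p) vs = ys"
      using \<beta>(3,2) unfolding cancel(1) by (rule map_gal_append3E)
    obtain a b where ab: "es = [a, b]" "snd p a = i" "snd p b = e_inv W i"
      using es(3) by (rule map_eq_pairE)
    note us = es(1)[unfolded ab(1)] es(2) ab(2,3) es(4)
    \<comment> \<open>This is where uniqueness of lifts enters: the lift of an inverse pair is
      itself an inverse pair.\<close>
    then have "b = e_inv V a"
      using \<beta>(1) e_inv_map_iff[of a b] by auto
    then have "homotopic M V \<beta> (C, us @ vs)"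
      using V.homotopic_elem[OF elem_homotopy.cancel[of M V C us a vs]] \<beta>(1) us(1) by simp
    then show ?thesis
      using us cancel assms(3) by (intro exI[of _ "(C, us @ vs)"]) (auto simp: map_gal_def)
  next
    case (merge D xs i j ys)
    obtain us es vs where es: "\<beta> = (C, us @ es @ vs)" "map (snd p) us = xs"
      "map (snd p) es = [i, j]" "map (snd p) vs = ys"
      using \<beta>(3,2) unfolding merge(1) by (rule map_gal_append3E)
    obtain a b where ab: "es = [a, b]" "snd p a = i" "snd p b = j"
      using es(3) by (rule map_eq_pairE)
    note us = es(1)[unfolded ab(1)] es(2) ab(2,3) es(4)
    have edges: "a \<in> edges M V" "b \<in> edges M V" "e_ter V a = e_ini V b"
      using \<beta>(1) us(1) by auto
    then have "fst a = fst b" "b \<noteq> e_inv V a"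
      using us merge(4,5) e_inv_map_iff[of a b] edge_map(4)[of a] edge_map(4)[of b] by auto
    moreover from this have "homotopic M V \<beta> (C, us @ [e_comp V a b] @ vs)"
      using V.homotopic_elem[OF elem_homotopy.merge[of M V C us a b vs]] \<beta>(1) us(1) by simp
    ultimately show ?thesis
      using us edges merge assms(3) edge_map_comp[of a b]
      by (intro exI[of _ "(C, us @ [e_comp V a b] @ vs)"]) (auto simp: map_gal_def)
  next
    case (suite D xs ds ys)
    obtain us es vs where us: "\<beta> = (C, us @ es @ vs)" "map (snd p) us = xs"
      "map (snd p) es = ds" "map (snd p) vs = ys"
      using \<beta>(3,2) unfolding suite(1) by (rule map_gal_append3E)
    \<comment> \<open>The covering condition speaks of galleries with a base chamber, so the lifted
      prefix has to end over the chamber where \<open>ds\<close> is based.\<close>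
    have "map_gal p (gal_ter V (C, us), es) = (gal_ter W (D, xs), ds)"
      using us \<beta>(1) suite(1) assms(3) edge_path_map(2)[of C us] by (simp add: map_gal_def)
    then have "is_suite M V (gal_ter V (C, us), es)"
      using covering suite(4) \<beta>(1) us(1) unfolding weyl_covering_def by auto
    then have "homotopic M V \<beta> (C, us @ vs)"
      using V.homotopic_suite \<beta>(1) us(1) by simp
    then show ?thesis
      using us suite assms(3) by (intro exI[of _ "(C, us @ vs)"]) (auto simp: map_gal_def)
  qed
  then show ?thesis using \<beta> by blast
qed

text \<open>Lift the moves one after another, each starting from the lift reached so far. Since
  homotopies fix initial chambers, all these lifts start at \<open>fst \<beta>\<close>.\<close>

lemma homotopy_lift:
  assumes "homotopic M W (map_gal p \<beta>) \<delta>" "is_gallery M V \<beta>"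
  shows "\<exists>\<beta>'. homotopic M V \<beta> \<beta>' \<and> map_gal p \<beta>' = \<delta>"
  using assms(1)
proof (induction rule: W.homotopic_induct)
  case refl
  then show ?case using assms(2) V.homotopic_refl by blast
next
  case (step \<delta> \<epsilon>)
  then obtain \<alpha> where \<alpha>: "homotopic M V \<beta> \<alpha>" "map_gal p \<alpha> = \<delta>" by blast
  have ini: "fst \<alpha> \<in> chambers V" "fst p (fst \<alpha>) = fst \<delta>" "fst \<epsilon> = fst \<delta>"
    using V.homotopic_endpoints(2)[OF \<alpha>(1)] V.gallery_chambers \<alpha>(2) step.hyps(2)
      W.elem_homotopy_endpoints[of \<delta> \<epsilon>] W.elem_homotopy_endpoints[of \<epsilon> \<delta>]
    by (auto simp: map_gal_def)
  have "\<exists>\<eta> \<zeta>. homotopic M V \<eta> \<zeta> \<and> fst \<eta> = fst \<alpha> \<and> map_gal p \<eta> = \<delta> \<and> map_gal p \<zeta> = \<epsilon>"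
    using step.hyps(2)
  proof
    assume "elem_homotopy M W \<delta> \<epsilon>"
    then show ?thesis using elem_homotopy_lift ini by blast
  next
    assume "elem_homotopy M W \<epsilon> \<delta>"
    then obtain \<eta> \<zeta> where "homotopic M V \<eta> \<zeta>" "fst \<eta> = fst \<alpha>" "map_gal p \<eta> = \<epsilon>" "map_gal p \<zeta> = \<delta>"
      using elem_homotopy_lift[of \<epsilon> \<delta> "fst \<alpha>"] ini by auto
    \<comment> \<open>For an inverse move the lifted pair comes in the opposite order; swapping it
      keeps the common initial chamber.\<close>
    then show ?thesis
      using V.homotopic_sym[of \<eta> \<zeta>] V.homotopic_endpoints(3)[of \<eta> \<zeta>] by metis
  qed
  then obtain \<eta> \<zeta> where \<eta>: "homotopic M V \<eta> \<zeta>" "fst \<eta> = fst \<alpha>" "map_gal p \<eta> = \<delta>" "map_gal p \<zeta> = \<epsilon>"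
    by blast
  \<comment> \<open>The lifted move begins at some lift of \<open>\<delta>\<close> from
    \<open>fst \<alpha>\<close>; unique lifting identifies it with \<open>\<alpha>\<close>, so the
    homotopies can be joined.\<close>
  then have "\<eta> = \<alpha>"
    using gallery_map_inj[of \<eta> \<alpha>] V.homotopic_endpoints(1)[OF \<eta>(1)]
      V.homotopic_endpoints(2)[OF \<alpha>(1)] \<alpha>(2) by simp
  then show ?case using \<eta> \<alpha>(1) V.homotopic_trans by blast
qed

section \<open>The induced homomorphism\<close>

text \<open>Well-definedness: by \<open>homotopic_map\<close> the union in
  \<open>induced_map\<close> runs over a single class.\<close>

lemma induced_map_hclass:
  assumes "is_gallery M V \<beta>"
  shows "snd (induced_map M W p) (hclass M V \<beta>) = hclass M W (map_gal p \<beta>)"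
proof -
  have "hclass M W (map_gal p \<gamma>) = hclass M W (map_gal p \<beta>)" if "homotopic M V \<beta> \<gamma>" for \<gamma>
    using homotopic_map[OF that] W.hclass_eq_iff[OF gallery_map(1)[OF assms]] by metis
  then have "(\<lambda>\<gamma>. hclass M W (map_gal p \<gamma>)) ` hclass M V \<beta> = {hclass M W (map_gal p \<beta>)}"
    by (rule V.image_hclass_const[OF assms])
  then show ?thesis by (simp add: induced_map_def)
qed

lemma map_gal_append: "map_gal p (gal_append \<beta> \<gamma>) = gal_append (map_gal p \<beta>) (map_gal p \<gamma>)"
  by (simp add: map_gal_def gal_append_def)

lemma fst_map_gal [simp]: "fst (map_gal p \<beta>) = fst p (fst \<beta>)"
  by (simp add: map_gal_def)

lemma groupoid_hom_induced_map:
  "groupoid_hom (fundamental_groupoid M V) (fundamental_groupoid M W) (induced_map M W p)"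
proof -
  have "fst (induced_map M W p) = fst p"
    by (simp add: induced_map_def)
  then show ?thesis
    unfolding groupoid_hom_def
    by (intro conjI ballI impI; (elim V.fundamental_groupoid_arrowE)?;
        simp add: V.is_groupoid_fundamental_groupoid W.is_groupoid_fundamental_groupoid
          V.fundamental_groupoid_verts W.fundamental_groupoid_verts chamber_map W.hclass_arrow
          V.fundamental_groupoid_simps W.fundamental_groupoid_simps
          V.fundamental_groupoid_comp W.fundamental_groupoid_comp V.gallery_append
          induced_map_hclass gallery_map map_gal_append)
qed

lemma induced_map_star_bij:
  assumes "C \<in> chambers V"
  shows "bij_betw (snd (induced_map M W p)) (arrows_from (fundamental_groupoid M V) C)
    (arrows_from (fundamental_groupoid M W) (fst p C))"
  unfolding bij_betw_def V.arrows_from_fundamental_groupoid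
    W.arrows_from_fundamental_groupoid
proof
  show "inj_on (snd (induced_map M W p)) {hclass M V \<beta> |\<beta>. is_gallery M V \<beta> \<and> fst \<beta> = C}"
  proof (rule inj_onI; clarify)
    fix \<beta> \<gamma>
    assume *: "is_gallery M V \<beta>" "is_gallery M V \<gamma>" "fst \<gamma> = fst \<beta>"
      and "snd (induced_map M W p) (hclass M V \<beta>) = snd (induced_map M W p) (hclass M V \<gamma>)"
    then have "homotopic M W (map_gal p \<beta>) (map_gal p \<gamma>)"
      using induced_map_hclass W.hclass_eq_iff gallery_map(1) by metis
    then obtain \<beta>' where \<beta>': "homotopic M V \<beta> \<beta>'" "map_gal p \<beta>' = map_gal p \<gamma>"
      using homotopy_lift *(1) by blast
    \<comment> \<open>The lifted homotopy ends at a lift of \<open>map_gal p \<gamma>\<close> that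
      starts at the same chamber as \<open>\<gamma>\<close>, hence at \<open>\<gamma>\<close>
      itself.\<close>
    then have "\<beta>' = \<gamma>"
      using gallery_map_inj[of \<beta>' \<gamma>] V.homotopic_endpoints[OF \<beta>'(1)] * by simp
    then show "hclass M V \<beta> = hclass M V \<gamma>"
      using V.hclass_eq_iff[OF *(1)] \<beta>'(1) by simp
  qed
  show "snd (induced_map M W p) ` {hclass M V \<beta> |\<beta>. is_gallery M V \<beta> \<and> fst \<beta> = C} =
    {hclass M W \<gamma> |\<gamma>. is_gallery M W \<gamma> \<and> fst \<gamma> = fst p C}"
  proof (intro subset_antisym subsetI)
    fix X assume "X \<in> snd (induced_map M W p) ` {hclass M V \<beta> |\<beta>. is_gallery M V \<beta> \<and> fst \<beta> = C}"
    then obtain \<beta> where "is_gallery M V \<beta>" "fst \<beta> = C" "X = hclass M W (map_gal p \<beta>)"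
      using induced_map_hclass by blast
    then show "X \<in> {hclass M W \<gamma> |\<gamma>. is_gallery M W \<gamma> \<and> fst \<gamma> = fst p C}"
      using gallery_map(1) fst_map_gal by blast
  next
    fix X assume "X \<in> {hclass M W \<gamma> |\<gamma>. is_gallery M W \<gamma> \<and> fst \<gamma> = fst p C}"
    then obtain \<gamma> where \<gamma>: "X = hclass M W \<gamma>" "is_gallery M W \<gamma>" "fst \<gamma> = fst p C" by blast
    then obtain \<beta> where "is_gallery M V \<beta>" "fst \<beta> = C" "map_gal p \<beta> = \<gamma>"
      using gallery_lift[OF \<gamma>(2) assms] by metis
    then show "X \<in> snd (induced_map M W p) ` {hclass M V \<beta> |\<beta>. is_gallery M V \<beta> \<and> fst \<beta> = C}"
      using induced_map_hclass \<gamma>(1) by blast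
  qed
qed

lemma induced_map_arrows:
  "snd (induced_map M W p) ` arrows (fundamental_groupoid M V) = arrows (fundamental_groupoid M W)"
proof
  show "snd (induced_map M W p) ` arrows (fundamental_groupoid M V) \<subseteq> arrows (fundamental_groupoid M W)"
    using groupoid_hom_induced_map unfolding groupoid_hom_def by blast
  show "arrows (fundamental_groupoid M W) \<subseteq> snd (induced_map M W p) ` arrows (fundamental_groupoid M V)"
  proof
    fix X assume "X \<in> arrows (fundamental_groupoid M W)"
    then obtain \<gamma> where \<gamma>: "is_gallery M W \<gamma>" "X = hclass M W \<gamma>"
      by (rule W.fundamental_groupoid_arrowE)
    \<comment> \<open>A gallery is lifted from a prescribed chamber, so surjectivity on chambers
      must first supply one over the start of \<open>\<gamma>\<close>.\<close>
    obtain C where "C \<in> chambers V" "fst p C = fst \<gamma>"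
      using W.gallery_chambers(1)[OF \<gamma>(1)] chamber_map_image by (metis imageE)
    then obtain \<beta> where "is_gallery M V \<beta>" "map_gal p \<beta> = \<gamma>"
      using gallery_lift[OF \<gamma>(1)] by metis
    then show "X \<in> snd (induced_map M W p) ` arrows (fundamental_groupoid M V)"
      using induced_map_hclass \<gamma>(2) V.hclass_arrow by blast
  qed
qed

lemma groupoid_covering_induced_map:
  "groupoid_covering (fundamental_groupoid M V) (fundamental_groupoid M W) (induced_map M W p)"
proof -
  have "fst (induced_map M W p) = fst p"
    by (simp add: induced_map_def)
  then show ?thesis
    using groupoid_hom_induced_map induced_map_arrows induced_map_star_bij chamber_map_image
    unfolding groupoid_covering_def V.fundamental_groupoid_verts W.fundamental_groupoid_verts
    by simp
qed

end

text \<open>The first conjunct confirms that \<open>induced_map\<close>, defined through unions over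
  representatives, really is the map of the classes of \<open>\<beta>\<close> to those of its
  image.\<close>

theorem proposition4p14:
  fixes M :: "'s coxeter_matrix"
    and V :: "('s, 'c, 'e) weyl_data"
    and W :: "('s, 'd, 'f) weyl_data"
    and p :: "('s, 'c, 'e, 'd, 'f) cs_map"
  assumes "is_coxeter_matrix M"
    and "two_weyl_graph M V"
    and "two_weyl_graph M W"
    and "weyl_covering M V W p"
  shows "(\<forall>\<beta>. is_gallery M V \<beta> \<longrightarrow>
            snd (induced_map M W p) (hclass M V \<beta>) = hclass M W (map_gal p \<beta>)) \<and>
         groupoid_covering (fundamental_groupoid M V) (fundamental_groupoid M W) (induced_map M W p)"
proof -
  interpret weyl_covering_of M V W p
    using assms(4) by unfold_locales (auto simp: weyl_covering_def weyl_morphism_def)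
  show ?thesis
    using induced_map_hclass groupoid_covering_induced_map by blast
qed

end
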